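(* For all integers $k\geq 4$ and $\ell\geq 1$, if $k$ is even or not divisible by $3$, then \[ f_2(k,\ell)\leq 2^\ell k^\ell(k+1)^\ell(k+2)^\ell. \]
   Context: A 2-coloring of a set $A\subseteq\mathbb{N}$ is a function $\Delta:A\to\{0,1\}$. For integers $r,k\geq 2$ and $\ell\geq 1$, $f_r(k,\ell)$ denotes the smallest positive integer $n$ such that every $r$-coloring $\Delta$ of $\{1,2,\ldots,n\}$ has a monochromatic solution to $1/x_1^{1/\ell}+\cdots+1/x_k^{1/\ell}=1/y^{1/\ell}$, i.e. elements $a_1,\ldots,a_k,b$ (with $a_1,\ldots,a_k$ not necessarily distinct) satisfying the equation and $\Delta(a_1)=\cdots=\Delta(a_k)=\Delta(b)$. *)

theory Defs
  imports Complex_Main "HOL-Library.Extended_Nat" "HOL-Library.FuncSet"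
begin

definition has_mono_solution :: "nat set \<Rightarrow> (nat \<Rightarrow> nat) \<Rightarrow> nat \<Rightarrow> nat \<Rightarrow> bool" where
  "has_mono_solution A \<Delta> k l \<longleftrightarrow>
     (\<exists>a b. (\<forall>i\<in>{1..k}. a i \<in> A) \<and> b \<in> A \<and>
        (\<Sum>i = 1..k. 1 / real (a i) powr (1 / real l)) = 1 / real b powr (1 / real l) \<and>
        (\<forall>i\<in>{1..k}. \<Delta> (a i) = \<Delta> b))"

(* An infimum in enat rather than a LEAST on nat: if no n has the property the value is
   infinity, so that a finite upper bound includes the existence of such an n. *)
definition f_num :: "nat \<Rightarrow> nat \<Rightarrow> nat \<Rightarrow> enat" where
  "f_num r k l = Inf {enat n |n. n > 0 \<and> (\<forall>\<Delta> \<in> {1..n} \<rightarrow> {0..<r}. has_mono_solution {1..n} \<Delta> k l)}"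

end

theory Submission
  imports Defs
begin

text \<open>
  Put N = 2k(k+1)(k+2) and colour a divisor d of N by the colour of (N/d)^l. A monochromatic
  solution of the original equation is then a monochromatic solution of d_1 + ... + d_k = e among
  the divisors of N. Suppose there is none.

  If c and 2c (c = 1, 2) had the same colour, then c(k+1) and c(k+2), as sums of copies of c and 2c,
  would have the other one, and so ck(k+1) and ck(k+2) the first one again; but
  k(k+2) = k(k+1) + (k-2) * 1 + 2. Hence 1 and 4 share a colour that 2 does not have, and 2k, being
  k times 2, has the colour of 1. Since 2k is a sum of k terms from 1, 3, 4, the number 3 has the
  colour of 2. Then 2k, 2k+2, 2k+4, being sums of k terms from 2, 3, all have the colour of 1, but
  one of the three is congruent to k modulo 3 and is therefore a sum of k terms from 1, 4.
\<close>

text \<open>\<open>no_mono\<close> groups the k summands by value, and three values suffice for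
  every sum in the argument. Its colour premises apply even to a value of multiplicity 0, so a spare
  slot is filled with some divisor of the right colour.\<close>

lemma same_colour_doubling_impossible:
  fixes P :: "nat \<Rightarrow> bool" and c k N :: nat
  assumes no_mono: "\<And>p q r x y z e. p + q + r = k \<Longrightarrow> p * x + q * y + r * z = e \<Longrightarrow>
      x dvd N \<Longrightarrow> y dvd N \<Longrightarrow> z dvd N \<Longrightarrow> e dvd N \<Longrightarrow> P x = P y \<Longrightarrow> P y = P z \<Longrightarrow> P z \<noteq> P e"
    and k: "k \<ge> 2" and dvd: "2 * c dvd N" "c * (k * (k + 1) * (k + 2)) dvd N"
  shows "P (2 * c) \<noteq> P c"
proof
  assume eq: "P (2 * c) = P c"
  \<comment> \<open>Removes the truncated differences k - 1 and k - 2 before the sums are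
    normalised.\<close>
  obtain m where m: "k = m + 2"
    using k by (metis add.commute le_Suc_ex)
  have d: "c dvd N" "c * (k + 1) dvd N" "c * (k + 2) dvd N"
    "c * (k * (k + 1)) dvd N" "c * (k * (k + 2)) dvd N"
  proof -
    have eqs: "c * (k * (k + 1) * (k + 2)) = c * (k + 1) * (k * (k + 2))"
      "c * (k * (k + 1) * (k + 2)) = c * (k + 2) * (k * (k + 1))"
      "c * (k * (k + 1) * (k + 2)) = c * (k * (k + 1)) * (k + 2)"
      "c * (k * (k + 1) * (k + 2)) = c * (k * (k + 2)) * (k + 1)"
      by (simp_all only: mult_ac)
    show "c dvd N"
      using dvd(2) by (rule dvd_mult_left)
    show "c * (k + 1) dvd N" "c * (k + 2) dvd N"
      "c * (k * (k + 1)) dvd N" "c * (k * (k + 2)) dvd N"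
      using dvd(2) eqs by (metis dvd_mult_left)+
  qed
  have 1: "P (c * (k + 1)) \<noteq> P c"
    using no_mono[of "k - 1" 1 0 c "2 * c" c "c * (k + 1)"] d dvd eq m
    by (auto simp: algebra_simps)
  have 2: "P (c * (k + 2)) \<noteq> P c"
    using no_mono[of "k - 2" 2 0 c "2 * c" c "c * (k + 2)"] d dvd eq m
    by (auto simp: algebra_simps)
  have 3: "P (c * (k * (k + 1))) = P c"
    using no_mono[of k 0 0 "c * (k + 1)" "c * (k + 1)" "c * (k + 1)" "c * (k * (k + 1))"] d 1
    by (auto simp: algebra_simps)
  have 4: "P (c * (k * (k + 2))) = P c"
    using no_mono[of k 0 0 "c * (k + 2)" "c * (k + 2)" "c * (k + 2)" "c * (k * (k + 2))"] d 2
    by (auto simp: algebra_simps)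
  have "(k - 2) * c + 1 * (2 * c) + 1 * (c * (k * (k + 1))) = c * (k * (k + 2))"
    using m by (simp add: algebra_simps)
  moreover have "k - 2 + 1 + 1 = k"
    using k by simp
  ultimately show False
    using no_mono[of "k - 2" 1 1 c "2 * c" "c * (k * (k + 1))" "c * (k * (k + 2))"] d dvd(1) eq 3 4
    by blast
qed

lemma no_two_colouring_avoids_mono_divisor_sums:
  fixes P :: "nat \<Rightarrow> bool" and k :: nat
  defines "N \<equiv> 2 * k * (k + 1) * (k + 2)"
  assumes no_mono: "\<And>p q r x y z e. p + q + r = k \<Longrightarrow> p * x + q * y + r * z = e \<Longrightarrow>
      x dvd N \<Longrightarrow> y dvd N \<Longrightarrow> z dvd N \<Longrightarrow> e dvd N \<Longrightarrow> P x = P y \<Longrightarrow> P y = P z \<Longrightarrow> P z \<noteq> P e"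
    and k: "k \<ge> 4"
  shows False
proof -
  \<comment> \<open>The values 3 and 4 can serve as summands only if they divide N.\<close>
  have "2 dvd k * (k + 1)"
    by simp
  then have four: "4 dvd N"
    unfolding N_def using mult_dvd_mono[of 2 2 2 "k * (k + 1)"]
    by (metis dvd_mult2 dvd_refl mult.assoc mult_2 numeral_Bit0 numeral_times_numeral semiring_norm(13))
  have "3 dvd k \<or> 3 dvd k + 1 \<or> 3 dvd k + 2"
    by presburger
  then have three: "3 dvd N"
    unfolding N_def by (metis dvd_mult dvd_mult2)
  have N: "2 dvd N" "2 * k dvd N" "2 * k + 2 dvd N" "2 * k + 4 dvd N"
  proof -
    have "N = 2 * (k * (k + 1) * (k + 2))" "N = 2 * k * ((k + 1) * (k + 2))"
      "N = (2 * k + 2) * (k * (k + 2))" "N = (2 * k + 4) * (k * (k + 1))"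
      by (simp_all add: N_def algebra_simps)
    then show "2 dvd N" "2 * k dvd N" "2 * k + 2 dvd N" "2 * k + 4 dvd N"
      by (metis dvd_triv_left)+
  qed
  have 2: "P 2 \<noteq> P 1"
  proof -
    have "1 * (k * (k + 1) * (k + 2)) dvd N"
      unfolding N_def by (metis dvd_triv_right mult.assoc mult_1)
    with same_colour_doubling_impossible[of k N P 1] no_mono N k show ?thesis
      by simp
  qed
  have "P 4 \<noteq> P 2"
  proof -
    have "2 * (k * (k + 1) * (k + 2)) dvd N"
      unfolding N_def by (simp only: mult.assoc dvd_refl)
    with same_colour_doubling_impossible[of k N P 2] no_mono four k show ?thesis
      by simp
  qed
  with 2 have 4: "P 4 = P 1"
    by blast
  have two_k: "P (2 * k) = P 1"
    using no_mono[of k 0 0 2 2 2 "2 * k"] N 2 by auto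
  have 3: "P 3 \<noteq> P 1"
  proof
    assume eq: "P 3 = P 1"
    show False
    \<comment> \<open>The k summands of 2k must average 2: equally many ones and threes if k is
      even; if k is odd, a single 4 is balanced by two extra ones.\<close>
    proof (cases "even k")
      case True
      then obtain j where "k = 2 * j" ..
      then show False
        using no_mono[of j j 0 1 3 4 "2 * k"] N three four eq 4 two_k by auto
    next
      case False
      then obtain j where "k = 2 * j + 1"
        using oddE by blast
      with k obtain i where "k = 2 * i + 3" "j = i + 1"
        by (cases j) auto
      then show False
        using no_mono[of "i + 2" i 1 1 3 4 "2 * k"] N three four eq 4 two_k by auto
    qed
  qed
  \<comment> \<open>Replacing a 1 by a 4 adds 3, so k terms from 1 and 4 give k + 3c with c \<le> k.
    This reaches 2k + t when 3 divides k + t, and 0, 2, 4 cover all residues modulo 3.\<close>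
  obtain t where t: "t \<in> {0, 2, 4}" "3 dvd k + t"
  proof -
    have "3 dvd k + 0 \<or> 3 dvd k + 2 \<or> 3 dvd k + 4"
      by presburger
    with that show thesis
      by blast
  qed
  \<comment> \<open>The bound k \<ge> 4 leaves room for t threes among k summands.\<close>
  have tN: "2 * k + t dvd N" and tk: "t \<le> k"
    using t(1) N k by auto
  obtain c where c: "k + t = 3 * c"
    using t(2) ..
  have "(k - t) * 2 + t * 3 + 0 * 3 = 2 * k + t"
    using tk by (simp add: algebra_simps)
  then have "P (2 * k + t) = P 1"
    using no_mono[of "k - t" t 0 2 3 3 "2 * k + t"] N tN tk three 2 3 by auto
  moreover have "c \<le> k" "(k - c) * 1 + c * 4 + 0 * 4 = 2 * k + t"
    using c tk by auto
  ultimately show False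
    using no_mono[of "k - c" c 0 1 4 4 "2 * k + t"] tN four 4 by auto
qed

lemma inverse_root_codivisor_power:
  fixes d l N :: nat
  assumes "d dvd N" "N > 0" "l \<ge> 1"
  shows "1 / real ((N div d) ^ l) powr (1 / real l) = real d / real N"
proof -
  \<comment> \<open>Rewriting a natural power as \<open>powr\<close> requires a positive
    base.\<close>
  have "N div d > 0"
    using assms by (metis dvd_div_eq_0_iff gr0I less_irrefl)
  moreover have "real (N div d) = real N / real d"
    using assms(1) by (rule real_of_nat_div)
  moreover have "real ((N div d) ^ l) = real (N div d) powr real l"
    using calculation(1) by (simp add: powr_realpow)
  ultimately show ?thesis
    using assms(3) by (simp add: powr_powr)
qed

lemma codivisor_power_in_range:
  fixes d l N :: nat
  assumes "d dvd N" "N > 0"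
  shows "(N div d) ^ l \<in> {1..N ^ l}"
proof -
  have "N div d > 0"
    using assms by (metis dvd_div_eq_0_iff gr0I less_irrefl)
  then show ?thesis
    by (simp add: Suc_le_eq power_mono)
qed

text \<open>Dividing the identity between divisors by N turns each divisor d into d / N, the
  reciprocal l-th root of (N/d)^l. The grouped sum becomes an indexed one through \<open>g\<close>,
  which lists the values in consecutive blocks.\<close>

lemma has_mono_solution_from_divisors:
  fixes N k l :: nat
  assumes pos: "N > 0" "l \<ge> 1"
    and sum: "p + q + r = k" "p * x + q * y + r * z = e"
    and dvd: "x dvd N" "y dvd N" "z dvd N" "e dvd N"
    and col: "\<forall>d\<in>{x, y, z}. \<Delta> ((N div d) ^ l) = \<Delta> ((N div e) ^ l)"
  shows "has_mono_solution {1..N ^ l} \<Delta> k l"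
proof -
  define g where "g i = (if i \<le> p then x else if i \<le> p + q then y else z)" for i
  have g: "g i \<in> {x, y, z}" for i
    by (simp add: g_def)
  have g_dvd: "g i dvd N" for i
    using g[of i] dvd by auto
  have "{1..k} = {1..p} \<union> {p + 1..p + q} \<union> {p + q + 1..p + q + r}"
    using sum(1) by auto
  then have "(\<Sum>i = 1..k. g i) =
      (\<Sum>i = 1..p. g i) + (\<Sum>i = p + 1..p + q. g i) + (\<Sum>i = p + q + 1..p + q + r. g i)"
    by (simp only:) (subst sum.union_disjoint, auto)+
  also have "\<dots> = (\<Sum>i = 1..p. x) + (\<Sum>i = p + 1..p + q. y) + (\<Sum>i = p + q + 1..p + q + r. z)"
    by (intro arg_cong2[where f = "(+)"] sum.cong) (auto simp: g_def)
  also have "\<dots> = e"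
    using sum(2) by simp
  finally have sum_g: "(\<Sum>i = 1..k. g i) = e" .
  have "(\<Sum>i = 1..k. 1 / real ((N div g i) ^ l) powr (1 / real l)) = (\<Sum>i = 1..k. real (g i) / real N)"
    by (intro sum.cong refl inverse_root_codivisor_power g_dvd pos)
  also have "\<dots> = real e / real N"
    by (simp add: sum_g[symmetric] sum_divide_distrib)
  also have "\<dots> = 1 / real ((N div e) ^ l) powr (1 / real l)"
    by (simp only: inverse_root_codivisor_power[OF dvd(4) pos])
  finally show ?thesis
    unfolding has_mono_solution_def using codivisor_power_in_range[OF _ pos(1)] g g_dvd dvd(4) col
    by (intro exI[of _ "\<lambda>i. (N div g i) ^ l"] exI[of _ "(N div e) ^ l"]) blast
qed

theorem theorem4p3:
  fixes k l :: nat
  assumes "k \<ge> 4" and "l \<ge> 1" and "even k \<or> \<not> 3 dvd k"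
  shows "f_num 2 k l \<le> enat (2 ^ l * k ^ l * (k + 1) ^ l * (k + 2) ^ l)"
proof -
  define N where "N = 2 * k * (k + 1) * (k + 2)"
  have pos: "N > 0"
    using assms(1) by (simp add: N_def)
  have "has_mono_solution {1..N ^ l} \<Delta> k l" if \<Delta>: "\<Delta> \<in> {1..N ^ l} \<rightarrow> {0..<2}" for \<Delta>
  proof (rule ccontr)
    assume no: "\<not> ?thesis"
    define P where "P d \<longleftrightarrow> \<Delta> ((N div d) ^ l) = 0" for d
    \<comment> \<open>Being zero or not determines a colour below 2. Divisibility keeps the
      arguments in the interval where \<Delta> is known to be below 2.\<close>
    have eq: "\<Delta> ((N div d) ^ l) = \<Delta> ((N div e) ^ l)" if "d dvd N" "e dvd N" "P d = P e" for d e
    proof -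
      have "\<Delta> ((N div c) ^ l) < 2" if "c dvd N" for c
        using \<Delta> codivisor_power_in_range[OF that pos] by auto
      from this[OF that(1)] this[OF that(2)] that(3) show ?thesis
        unfolding P_def by linarith
    qed
    show False
    proof (rule no_two_colouring_avoids_mono_divisor_sums[of k P, folded N_def])
      fix p q r x y z e
      assume *: "p + q + r = k" "p * x + q * y + r * z = e"
        "x dvd N" "y dvd N" "z dvd N" "e dvd N" "P x = P y" "P y = P z"
      show "P z \<noteq> P e"
      proof
        assume "P z = P e"
        with * eq have "\<forall>d\<in>{x, y, z}. \<Delta> ((N div d) ^ l) = \<Delta> ((N div e) ^ l)"
          by blast
        with has_mono_solution_from_divisors[OF pos assms(2) *(1-6)] no show False
          by blast
      qed
    qed (fact assms(1))
  qed
  with pos have "enat (N ^ l) \<in> {enat n |n. n > 0 \<and>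
      (\<forall>\<Delta> \<in> {1..n} \<rightarrow> {0..<2}. has_mono_solution {1..n} \<Delta> k l)}"
    by auto
  then have "f_num 2 k l \<le> enat (N ^ l)"
    unfolding f_num_def by (rule Inf_lower)
  then show ?thesis
    by (simp only: N_def power_mult_distrib)
qed

end
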